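(* Let $X$ and $Y$ be Banach spaces, $M\subseteq X$ an $n$-dimensional differentiable manifold that is Lipschitz in $X$, $K\subseteq M$ a compact set, and let $Q_N\colon Y\to Y$ ($N\in\mathbb{N}$) be bounded linear maps. Assume that there exist a subspace $\widetilde Y\subseteq Y$ and $D>0$ such that $\|Q_N|_{\widetilde Y}\|_{\mathcal{L}(\widetilde Y,Y)}\le D$ for every $N\in\mathbb{N}$ and $\lim_{N\to\infty}\|y-Q_Ny\|_Y=0$ for every $y\in\widetilde Y$. Let $F\in C^1(M,Y)$ satisfy: (1) $F$ is injective; (2) the differential $dF_x\colon T_xM\to Y$ is injective for every $x\in M$; (3) $F(x)-F(y)\in\widetilde Y$ for every $x,y\in K$; (4) the range of $dF_x$ is contained in $\widetilde Y$ for every $x\in M$. Then, for some $C>0$ and every sufficiently large $N\in\mathbb{N}$, $$\|x-y\|_X\le C\,\|Q_NF(x)-Q_NF(y)\|_Y,\qquad x,y\in K.$$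
   Context: A subset $M$ of a Banach space $X$ is an $n$-dimensional differentiable manifold in $X$ if there is an atlas $\{(U_i,\varphi_i)\}_{i\in I}$ with $U_i\subseteq M$, $\bigcup_{i}U_i=M$, $\varphi_i\colon U_i\to\mathbb{R}^n$, such that: (i) each $U_i$ is open in $M$ (topology inherited from $X$) and $\varphi_i(U_i)$ is open in $\mathbb{R}^n$; (ii) each $\varphi_i$ is a homeomorphism onto $\varphi_i(U_i)$; (iii) all transition maps $\varphi_j\circ\varphi_i^{-1}\colon\varphi_i(U_i\cap U_j)\to\varphi_j(U_i\cap U_j)$ are continuously differentiable. $M$ is Lipschitz in $X$ if there is $\ell\in(0,1]$ such that $|\varphi_i(x)-\varphi_i(y)|\ge\ell\|x-y\|_X$ for every $i\in I$ and all $x,y\in U_i$. $F\in C^1(M,Y)$ means that for every $i\in I$ the map $F\circ\varphi_i^{-1}\colon\varphi_i(U_i)\to Y$ is Fréchet differentiable with continuous derivative $\varphi_i(U_i)\to\mathcal{L}(\mathbb{R}^n,Y)$. The tangent space $T_xM$ is identified with $\mathbb{R}^n$ via a chart $(U_i,\varphi_i)$ with $x\in U_i$, and $dF_xh=(F\circ\varphi_i^{-1})'(\varphi_i(x))h$, $h\in\mathbb{R}^n$; injectivity and range of $dF_x$ do not depend on the chart. *)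

theory Defs
  imports "HOL-Analysis.Analysis"
begin

definition C1_on :: "'e::real_normed_vector set \<Rightarrow> ('e \<Rightarrow> 'f::real_normed_vector) \<Rightarrow> bool" where
  "C1_on S f \<longleftrightarrow> (\<exists>f' :: 'e \<Rightarrow> 'e \<Rightarrow>\<^sub>L 'f.
     (\<forall>x\<in>S. (f has_derivative blinfun_apply (f' x)) (at x)) \<and> continuous_on S f')"

text \<open>The inverse of the chart \<open>\<phi> i : U i \<rightarrow> \<phi> i ` U i\<close>; it is only meaningful on \<open>\<phi> i ` U i\<close>.\<close>

definition chart_inv :: "('i \<Rightarrow> 'x set) \<Rightarrow> ('i \<Rightarrow> 'x \<Rightarrow> 'e) \<Rightarrow> 'i \<Rightarrow> 'e \<Rightarrow> 'x" where
  "chart_inv U \<phi> i = inv_into (U i) (\<phi> i)"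

text \<open>\<open>M\<close> is a differentiable manifold in the ambient space \<open>'x\<close>, of dimension \<open>CARD('n)\<close>, with
  atlas \<open>(U i, \<phi> i)\<close>, \<open>i \<in> I\<close>. No differentiable structure of \<open>'x\<close> itself is involved.\<close>

definition manifold_atlas ::
  "'x::real_normed_vector set \<Rightarrow> 'i set \<Rightarrow> ('i \<Rightarrow> 'x set) \<Rightarrow> ('i \<Rightarrow> 'x \<Rightarrow> real ^ 'n::finite) \<Rightarrow> bool" where
  "manifold_atlas M I U \<phi> \<longleftrightarrow>
     (\<forall>i\<in>I. U i \<subseteq> M) \<and> (\<Union>i\<in>I. U i) = M \<and>
     (\<forall>i\<in>I. openin (top_of_set M) (U i) \<and> open (\<phi> i ` U i)) \<and>
     (\<forall>i\<in>I. homeomorphism (U i) (\<phi> i ` U i) (\<phi> i) (chart_inv U \<phi> i)) \<and>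
     (\<forall>i\<in>I. \<forall>j\<in>I. C1_on (\<phi> i ` (U i \<inter> U j)) (\<phi> j \<circ> chart_inv U \<phi> i))"

definition lipschitz_atlas ::
  "'i set \<Rightarrow> ('i \<Rightarrow> 'x::real_normed_vector set) \<Rightarrow> ('i \<Rightarrow> 'x \<Rightarrow> real ^ 'n::finite) \<Rightarrow> bool" where
  "lipschitz_atlas I U \<phi> \<longleftrightarrow>
     (\<exists>l. 0 < l \<and> l \<le> 1 \<and> (\<forall>i\<in>I. \<forall>x\<in>U i. \<forall>y\<in>U i. norm (\<phi> i x - \<phi> i y) \<ge> l * norm (x - y)))"

definition C1_manifold ::
  "'i set \<Rightarrow> ('i \<Rightarrow> 'x set) \<Rightarrow> ('i \<Rightarrow> 'x \<Rightarrow> real ^ 'n::finite) \<Rightarrow> ('x \<Rightarrow> 'y::real_normed_vector) \<Rightarrow> bool" where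
  "C1_manifold I U \<phi> F \<longleftrightarrow> (\<forall>i\<in>I. C1_on (\<phi> i ` U i) (F \<circ> chart_inv U \<phi> i))"

definition chart_differential ::
  "('i \<Rightarrow> 'x set) \<Rightarrow> ('i \<Rightarrow> 'x \<Rightarrow> real ^ 'n::finite) \<Rightarrow> ('x \<Rightarrow> 'y::real_normed_vector) \<Rightarrow>
   'i \<Rightarrow> 'x \<Rightarrow> real ^ 'n \<Rightarrow> 'y" where
  "chart_differential U \<phi> F i x = frechet_derivative (F \<circ> chart_inv U \<phi> i) (at (\<phi> i x))"

text \<open>The tangent space at \<open>x\<close> is identified with \<open>real ^ 'n\<close> through some chart around \<open>x\<close>. The choice
  affects neither injectivity nor the range of the differential; see \<open>inj_range_manifold_differential\<close>
  below.\<close>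

definition manifold_differential ::
  "'i set \<Rightarrow> ('i \<Rightarrow> 'x set) \<Rightarrow> ('i \<Rightarrow> 'x \<Rightarrow> real ^ 'n::finite) \<Rightarrow> ('x \<Rightarrow> 'y::real_normed_vector) \<Rightarrow>
   'x \<Rightarrow> real ^ 'n \<Rightarrow> 'y" where
  "manifold_differential I U \<phi> F x = chart_differential U \<phi> F (SOME i. i \<in> I \<and> x \<in> U i) x"

text \<open>Operator norm of the restriction of a bounded linear map to a subspace, in the form of
  \<^const>\<open>onorm\<close>.\<close>

definition onorm_on :: "'a::real_normed_vector set \<Rightarrow> ('a \<Rightarrow> 'b::real_normed_vector) \<Rightarrow> real" where
  "onorm_on S f = (SUP y\<in>S. norm (f y) / norm y)"

lemma onorm_on_le_iff:
  assumes "bounded_linear f" "subspace S" "0 \<le> D"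
  shows "onorm_on S f \<le> D \<longleftrightarrow> (\<forall>y\<in>S. norm (f y) \<le> D * norm y)"
proof -
  interpret bounded_linear f by fact
  have bdd: "bdd_above ((\<lambda>y. norm (f y) / norm y) ` S)"
    by (rule bdd_aboveI2[of _ _ "onorm f"]) (rule le_onorm[OF assms(1)])
  have "S \<noteq> {}"
    using subspace_0[OF assms(2)] by blast
  then have "onorm_on S f \<le> D \<longleftrightarrow> (\<forall>y\<in>S. norm (f y) / norm y \<le> D)"
    unfolding onorm_on_def by (rule cSUP_le_iff[OF _ bdd])
  moreover have "norm (f y) / norm y \<le> D \<longleftrightarrow> norm (f y) \<le> D * norm y" for y
    using assms(3) by (cases "y = 0") (auto simp: zero divide_simps)
  ultimately show ?thesis by simp
qed

lemma chart_differential_comp: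
  assumes M: "manifold_atlas M I U \<phi>" and F: "C1_manifold I U \<phi> F"
    and i: "i \<in> I" "x \<in> U i" and j: "j \<in> I" "x \<in> U j"
  obtains T where "linear T"
    "chart_differential U \<phi> F i x = chart_differential U \<phi> F j x \<circ> T"
proof -
  let ?p = "\<phi> i x"
  have hi: "homeomorphism (U i) (\<phi> i ` U i) (\<phi> i) (chart_inv U \<phi> i)"
    and hj: "homeomorphism (U j) (\<phi> j ` U j) (\<phi> j) (chart_inv U \<phi> j)"
    and oi: "open (\<phi> i ` U i)"
    and ui: "openin (top_of_set M) (U i)" "openin (top_of_set M) (U j)" "U i \<subseteq> M"
    and t: "C1_on (\<phi> i ` (U i \<inter> U j)) (\<phi> j \<circ> chart_inv U \<phi> i)"
    using M i j unfolding manifold_atlas_def by blast+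
  have invi: "chart_inv U \<phi> i (\<phi> i y) = y" if "y \<in> U i" for y
    using homeomorphism_apply1[OF hi that] .
  have invj: "chart_inv U \<phi> j (\<phi> j y) = y" if "y \<in> U j" for y
    using homeomorphism_apply1[OF hj that] .
  obtain A where A: "((\<phi> j \<circ> chart_inv U \<phi> i) has_derivative blinfun_apply A) (at ?p)"
    using t i j unfolding C1_on_def by blast
  obtain Gi where Gi: "((F \<circ> chart_inv U \<phi> i) has_derivative blinfun_apply Gi) (at ?p)"
    using F i unfolding C1_manifold_def C1_on_def by blast
  obtain Gj where Gj: "((F \<circ> chart_inv U \<phi> j) has_derivative blinfun_apply Gj) (at (\<phi> j x))"
    using F j unfolding C1_manifold_def C1_on_def by blast
  have "openin (top_of_set (U i)) (U i \<inter> U j)"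
    using openin_subset_trans[OF openin_Int[OF ui(1,2)]] ui(3) by blast
  then have "openin (top_of_set (\<phi> i ` U i)) (\<phi> i ` (U i \<inter> U j))"
    by (rule homeomorphism_imp_open_map[OF hi])
  then have O: "open (\<phi> i ` (U i \<inter> U j))"
    using oi openin_open_eq by blast
  have "((F \<circ> chart_inv U \<phi> j) \<circ> (\<phi> j \<circ> chart_inv U \<phi> i) has_derivative blinfun_apply Gj \<circ> blinfun_apply A) (at ?p)"
    using A Gj by (intro diff_chain_at) (simp_all add: invi i)
  then have "((F \<circ> chart_inv U \<phi> i) has_derivative blinfun_apply Gj \<circ> blinfun_apply A) (at ?p)"
    by (rule has_derivative_transform_within_open[OF _ O]) (use i j invi invj in auto)
  then have "chart_differential U \<phi> F i x = chart_differential U \<phi> F j x \<circ> blinfun_apply A"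
    unfolding chart_differential_def
    using frechet_derivative_at[OF Gj] frechet_derivative_at by metis
  then show ?thesis
    using that blinfun.bounded_linear_right bounded_linear.linear by blast
qed

lemma inj_range_manifold_differential:
  assumes M: "manifold_atlas M I U \<phi>" and F: "C1_manifold I U \<phi> F"
    and i: "i \<in> I" "x \<in> U i"
  shows "inj (manifold_differential I U \<phi> F x) \<longleftrightarrow> inj (chart_differential U \<phi> F i x)"
    and "range (manifold_differential I U \<phi> F x) = range (chart_differential U \<phi> F i x)"
proof -
  define j where "j = (SOME i. i \<in> I \<and> x \<in> U i)"
  have j: "j \<in> I" "x \<in> U j"
    using someI[of "\<lambda>i. i \<in> I \<and> x \<in> U i" i] i unfolding j_def by auto
  have eq: "manifold_differential I U \<phi> F x = chart_differential U \<phi> F j x"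
    unfolding manifold_differential_def j_def ..
  have inj: "inj (chart_differential U \<phi> F b x)"
    if ab: "a \<in> I" "x \<in> U a" "b \<in> I" "x \<in> U b" and "inj (chart_differential U \<phi> F a x)" for a b
  proof -
    obtain T where T: "linear T"
      "chart_differential U \<phi> F a x = chart_differential U \<phi> F b x \<circ> T"
      using chart_differential_comp[OF M F ab] by blast
    have "inj T"
      using that(5) unfolding T(2) by (rule inj_on_imageI2)
    then have "surj T"
      using T(1) linear_injective_imp_surjective by blast
    then show ?thesis
      using that(5) unfolding T(2) inj_def surj_def comp_def by metis
  qed
  have range: "range (chart_differential U \<phi> F a x) \<subseteq> range (chart_differential U \<phi> F b x)"
    if ab: "a \<in> I" "x \<in> U a" "b \<in> I" "x \<in> U b" for a b
    using chart_differential_comp[OF M F ab] by (metis image_comp image_mono subset_UNIV)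
  show "inj (manifold_differential I U \<phi> F x) \<longleftrightarrow> inj (chart_differential U \<phi> F i x)"
    using inj i j unfolding eq by blast
  show "range (manifold_differential I U \<phi> F x) = range (chart_differential U \<phi> F i x)"
    using range i j unfolding eq by blast
qed

end

theory Submission
  imports Defs
begin

text \<open>
  The estimate is local in the pair \<open>(x, y)\<close>: once every point of the compact set \<open>K \<times> K\<close> has a
  neighbourhood with its own constant and its own threshold for \<open>N\<close>, finitely many of these
  neighbourhoods suffice and the largest constant works. Two kinds of points occur.

  At \<open>(x\<^sub>0, y\<^sub>0)\<close> with \<open>x\<^sub>0 \<noteq> y\<^sub>0\<close>, injectivity makes \<open>d = F x\<^sub>0 - F y\<^sub>0\<close> a nonzero element of the subspace,
  so \<open>Q N d\<close> is eventually not much shorter than \<open>d\<close>. The uniform bound \<open>D\<close> and continuity of \<open>F\<close> keep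
  \<open>Q N (F x - F y)\<close> away from \<open>0\<close> for all \<open>(x, y)\<close> close by, while \<open>x - y\<close> stays bounded on \<open>K\<close>
  (\<open>lower_bound_off_diagonal\<close>).

  At \<open>(x\<^sub>0, x\<^sub>0)\<close>, pass to a chart and let \<open>A\<close> be the derivative of the coordinate expression \<open>G\<close> of \<open>F\<close>.
  As \<open>A\<close> is injective on a finite-dimensional space it is bounded below, and pointwise convergence of \<open>Q N\<close>
  on the range of \<open>A\<close> is uniform on the unit ball, so \<open>Q N \<circ> A\<close> is eventually bounded below with a
  constant independent of \<open>N\<close> (\<open>eventually_compose_bounded_below\<close>). Near the base point the remainder
  \<open>G q - G r - A (q - r)\<close> is at most a small multiple of \<open>q - r\<close>, by the mean value inequality. For points
  coming from \<open>K\<close> this remainder lies in the subspace, being a difference of two of its elements;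
  there \<open>Q N\<close> has norm at most \<open>D\<close>, so applying \<open>Q N\<close> keeps the remainder small
  (\<open>lower_bound_near_regular_point\<close>). The Lipschitz property of the atlas turns \<open>q - r\<close> back into
  \<open>x - y\<close>.
\<close>

section \<open>From local bounds to a bound on a compact set\<close>

lemma local_bounds_imp_bound_on_compact:
  fixes f :: "'a::topological_space \<Rightarrow> real" and g :: "'b \<Rightarrow> 'a \<Rightarrow> real"
  assumes "compact S"
    and nonneg: "\<And>N q. 0 \<le> g N q"
    and local: "\<And>p. p \<in> S \<Longrightarrow>
      \<exists>V C. open V \<and> p \<in> V \<and> (\<forall>\<^sub>F N in \<F>. \<forall>q\<in>S \<inter> V. f q \<le> C * g N q)"
  shows "\<exists>C>0. \<forall>\<^sub>F N in \<F>. \<forall>q\<in>S. f q \<le> C * g N q"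
proof -
  have "\<forall>p\<in>S. \<exists>V C. open V \<and> p \<in> V \<and> (\<forall>\<^sub>F N in \<F>. \<forall>q\<in>S \<inter> V. f q \<le> C * g N q)"
    using local by (rule ballI)
  from bchoice[OF this] obtain V where V: "\<forall>p\<in>S. \<exists>C. open (V p) \<and> p \<in> V p \<and>
      (\<forall>\<^sub>F N in \<F>. \<forall>q\<in>S \<inter> V p. f q \<le> C * g N q)"
    by (rule exE)
  from bchoice[OF this] obtain C where C: "\<And>p. p \<in> S \<Longrightarrow>
      \<forall>\<^sub>F N in \<F>. \<forall>q\<in>S \<inter> V p. f q \<le> C p * g N q"
    by (elim exE) blast
  obtain T where T: "T \<subseteq> S" "finite T" "S \<subseteq> (\<Union>p\<in>T. V p)"
  proof (rule compactE_image[OF \<open>compact S\<close>])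
    show "open (V p)" if "p \<in> S" for p using V that by blast
    show "S \<subseteq> (\<Union>p\<in>S. V p)" using V by blast
  qed
  define B where "B = 1 + (\<Sum>p\<in>T. \<bar>C p\<bar>)"
  have B: "C p \<le> B" if "p \<in> T" for p
    using member_le_sum[of p T "\<lambda>p. \<bar>C p\<bar>"] that T(2) by (force simp: B_def)
  have "\<forall>\<^sub>F N in \<F>. \<forall>p\<in>T. \<forall>q\<in>S \<inter> V p. f q \<le> C p * g N q"
    using C T by (intro eventually_ball_finite) auto
  then have "\<forall>\<^sub>F N in \<F>. \<forall>q\<in>S. f q \<le> B * g N q"
  proof eventually_elim
    case (elim N)
    show ?case
    proof
      fix q assume "q \<in> S"
      then obtain p where p: "p \<in> T" "q \<in> V p" using T(3) by blast
      then have "f q \<le> C p * g N q" using elim \<open>q \<in> S\<close> by blast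
      also have "\<dots> \<le> B * g N q" using B[OF p(1)] nonneg by (rule mult_right_mono)
      finally show "f q \<le> B * g N q" .
    qed
  qed
  moreover have "B > 0" unfolding B_def by (simp add: add_pos_nonneg sum_nonneg)
  ultimately show ?thesis by blast
qed

section \<open>Lower bounds for injective linear maps\<close>

text \<open>The minimum over the compact unit sphere is positive; the target may be infinite-dimensional.\<close>

lemma linear_inj_bounded_below:
  fixes A :: "'e::euclidean_space \<Rightarrow> 'y::real_normed_vector"
  assumes A: "bounded_linear A" and "inj A"
  obtains a where "0 < a" "\<And>h. a * norm h \<le> norm (A h)"
proof -
  interpret bounded_linear A by fact
  obtain s where s: "s \<in> sphere 0 1" "\<And>h. h \<in> sphere 0 1 \<Longrightarrow> norm (A s) \<le> norm (A h)"
  proof -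
    obtain b :: 'e where "b \<in> Basis" using nonempty_Basis by blast
    then have "sphere (0::'e) 1 \<noteq> {}" by (auto simp: sphere_def intro: norm_Basis)
    moreover have "continuous_on (sphere 0 1) (\<lambda>h. norm (A h))"
      by (intro continuous_intros continuous_on)
    ultimately show ?thesis
      using continuous_attains_inf[OF compact_sphere] that by metis
  qed
  have "A s \<noteq> A 0" using injD[OF \<open>inj A\<close>, of s 0] s(1) by auto
  then have "0 < norm (A s)" by (simp add: zero)
  moreover have "norm (A s) * norm h \<le> norm (A h)" for h
  proof (cases "h = 0")
    case False
    have "norm (A s) \<le> norm (A (h /\<^sub>R norm h))" using False by (intro s(2)) simp
    also have "\<dots> = norm (A h) / norm h" by (simp add: scaleR divide_inverse mult.commute)
    finally show ?thesis using False by (simp add: field_simps)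
  qed (simp add: zero)
  ultimately show ?thesis using that by blast
qed

text \<open>On a finite-dimensional space, convergence of \<open>Q N \<circ> A\<close> on a basis already gives convergence in
  operator norm, so a lower bound of \<open>A\<close> survives up to an arbitrary loss.\<close>

lemma eventually_compose_bounded_below:
  fixes A :: "'e::euclidean_space \<Rightarrow> 'y::real_normed_vector"
  assumes A: "bounded_linear A" and Q: "\<And>N. bounded_linear (Q N)"
    and conv: "\<And>h. ((\<lambda>N. norm (A h - Q N (A h))) \<longlongrightarrow> 0) \<F>"
    and below: "\<And>h. a * norm h \<le> norm (A h)" and "b < a"
  shows "\<forall>\<^sub>F N in \<F>. \<forall>h. b * norm h \<le> norm (Q N (A h))"
proof -
  have "((\<lambda>N. \<Sum>e\<in>Basis. norm (A e - Q N (A e))) \<longlongrightarrow> 0) \<F>"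
    using conv by (intro tendsto_null_sum) auto
  then have "\<forall>\<^sub>F N in \<F>. (\<Sum>e\<in>Basis. norm (A e - Q N (A e))) < a - b"
    using \<open>b < a\<close> by (intro order_tendstoD) auto
  then show ?thesis
  proof eventually_elim
    case (elim N)
    have lin: "bounded_linear (\<lambda>h. A h - Q N (A h))"
      using A Q by (intro bounded_linear_sub bounded_linear_compose[OF Q])
    show ?case
    proof
      fix h
      have "norm (A h - Q N (A h)) \<le> onorm (\<lambda>h. A h - Q N (A h)) * norm h"
        using onorm[OF lin] .
      also have "\<dots> \<le> (\<Sum>e\<in>Basis. norm (A e - Q N (A e))) * norm h"
        by (intro mult_right_mono onorm_componentwise lin) auto
      also have "\<dots> \<le> (a - b) * norm h"
        using elim by (intro mult_right_mono) auto
      finally have "norm (A h - Q N (A h)) \<le> (a - b) * norm h" .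
      then show "b * norm h \<le> norm (Q N (A h))"
        using below[of h] norm_triangle_ineq2[of "A h" "Q N (A h)"]
        by (simp add: algebra_simps)
    qed
  qed
qed

section \<open>Local lower bounds\<close>

text \<open>The linearisation is taken at the fixed point \<open>p\<close>, so the remainder \<open>G u - G v - A (u - v)\<close> is a
  difference of two elements of \<open>Yt\<close>, even when \<open>Yt\<close> is not closed. Hence the bound by \<open>D\<close>, which
  holds on \<open>Yt\<close> alone, applies to it.\<close>

lemma lower_bound_near_regular_point:
  fixes G :: "'e::euclidean_space \<Rightarrow> 'y::real_normed_vector" and Q :: "'b \<Rightarrow> 'y \<Rightarrow> 'y"
  assumes "C1_on W G" "open W" "p \<in> W"
    and deriv: "(G has_derivative A) (at p)" and "inj A" "range A \<subseteq> Yt"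
    and Yt: "subspace Yt" and Q: "\<And>N. bounded_linear (Q N)" and "D > 0"
    and bound: "\<And>N y. y \<in> Yt \<Longrightarrow> norm (Q N y) \<le> D * norm y"
    and conv: "\<And>y. y \<in> Yt \<Longrightarrow> ((\<lambda>N. norm (y - Q N y)) \<longlongrightarrow> 0) \<F>"
  obtains r c where "0 < r" "ball p r \<subseteq> W" "0 < c"
    "\<forall>\<^sub>F N in \<F>. \<forall>u\<in>ball p r. \<forall>v\<in>ball p r. G u - G v \<in> Yt \<longrightarrow>
       c * norm (u - v) \<le> norm (Q N (G u) - Q N (G v))"
proof -
  obtain G' where G': "\<And>u. u \<in> W \<Longrightarrow> (G has_derivative blinfun_apply (G' u)) (at u)"
    and cont: "continuous_on W G'"
    using \<open>C1_on W G\<close> unfolding C1_on_def by blast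
  have A: "A = blinfun_apply (G' p)"
    using has_derivative_unique[OF deriv G'[OF \<open>p \<in> W\<close>]] .
  have blA: "bounded_linear A" using deriv by (rule has_derivative_bounded_linear)
  obtain a where a: "0 < a" "\<And>h. a * norm h \<le> norm (A h)"
    using linear_inj_bounded_below[OF blA \<open>inj A\<close>] by blast
  have QA: "\<forall>\<^sub>F N in \<F>. \<forall>h. (a/2) * norm h \<le> norm (Q N (A h))"
    using \<open>range A \<subseteq> Yt\<close> a
    by (intro eventually_compose_bounded_below[OF blA Q _ a(2)] conv) auto
  \<comment> \<open>After application of \<open>Q N\<close> the remainder then uses up half of the lower bound \<open>a / 2\<close>.\<close>
  define \<epsilon> where "\<epsilon> = a / (4 * D)"
  have "\<epsilon> > 0" using a \<open>D > 0\<close> by (simp add: \<epsilon>_def)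
  have "isCont G' p" using cont \<open>open W\<close> \<open>p \<in> W\<close> continuous_on_eq_continuous_at by blast
  then obtain r1 where r1: "r1 > 0" "\<And>u. dist u p < r1 \<Longrightarrow> dist (G' u) (G' p) < \<epsilon>"
    using \<open>\<epsilon> > 0\<close> unfolding continuous_at_eps_delta by blast
  obtain r2 where r2: "r2 > 0" "ball p r2 \<subseteq> W"
    using \<open>open W\<close> \<open>p \<in> W\<close> open_contains_ball by blast
  define r where "r = min r1 r2"
  have r: "r > 0" "ball p r \<subseteq> W" using r1(1) r2 by (auto simp: r_def)
  have rem: "norm (G u - G v - A (u - v)) \<le> norm (u - v) * \<epsilon>"
    if "u \<in> ball p r" "v \<in> ball p r" for u v
    unfolding A
  proof (rule differentiable_bound_linearization[where S = "ball p r" and f' = "\<lambda>u. blinfun_apply (G' u)"])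
    fix t :: real assume "t \<in> {0..1}"
    then show "v + t *\<^sub>R (u - v) \<in> ball p r"
      using convexD_alt[OF convex_ball that(2,1), of t] by (simp add: algebra_simps)
  next
    fix w assume w: "w \<in> ball p r"
    show "(G has_derivative blinfun_apply (G' w)) (at w within ball p r)"
      using G' w r(2) has_derivative_at_withinI by blast
    have "dist (G' w) (G' p) < \<epsilon>"
      using w by (intro r1(2)) (simp add: r_def dist_commute)
    then show "onorm (blinfun_apply (G' w) - blinfun_apply (G' p)) \<le> \<epsilon>"
      by (simp add: dist_norm norm_blinfun.rep_eq minus_blinfun.rep_eq fun_diff_def less_imp_le)
  qed (use r in auto)
  have "\<forall>\<^sub>F N in \<F>. \<forall>u\<in>ball p r. \<forall>v\<in>ball p r. G u - G v \<in> Yt \<longrightarrow>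
       (a/4) * norm (u - v) \<le> norm (Q N (G u) - Q N (G v))"
    using QA
  proof eventually_elim
    case (elim N)
    show ?case
    proof (intro ballI impI)
      fix u v assume uv: "u \<in> ball p r" "v \<in> ball p r" "G u - G v \<in> Yt"
      interpret Q: bounded_linear "Q N" by (rule Q)
      let ?R = "G u - G v - A (u - v)"
      have "?R \<in> Yt" using subspace_diff[OF Yt uv(3)] \<open>range A \<subseteq> Yt\<close> by blast
      then have "norm (Q N ?R) \<le> D * norm ?R" by (rule bound)
      also have "\<dots> \<le> D * (norm (u - v) * \<epsilon>)"
        using rem uv \<open>D > 0\<close> by (intro mult_left_mono) auto
      also have "\<dots> = (a/4) * norm (u - v)" using \<open>D > 0\<close> by (simp add: \<epsilon>_def)
      finally have "norm (Q N ?R) \<le> (a/4) * norm (u - v)" .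
      moreover have "(a/2) * norm (u - v) \<le> norm (Q N (A (u - v)))" using elim by blast
      moreover have "Q N (G u) - Q N (G v) = Q N (A (u - v)) + Q N ?R"
        by (simp add: Q.diff)
      ultimately show "(a/4) * norm (u - v) \<le> norm (Q N (G u) - Q N (G v))"
        using norm_diff_ineq[of "Q N (A (u - v))" "Q N ?R"] by (simp add: field_simps)
    qed
  qed
  then show ?thesis using r a(1) by (intro that[of r "a/4"]) auto
qed

text \<open>Away from the diagonal the distance of \<open>x\<close> and \<open>y\<close> enters only through the diameter of \<open>K\<close>, so a
  positive lower bound that is uniform in \<open>N\<close> is enough there.\<close>

lemma lower_bound_off_diagonal:
  fixes F :: "'x::metric_space \<Rightarrow> 'y::real_normed_vector" and Q :: "'b \<Rightarrow> 'y \<Rightarrow> 'y"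
  assumes F: "continuous_on K F" and "x0 \<in> K" "y0 \<in> K" "F x0 \<noteq> F y0"
    and diff: "\<And>x y. x \<in> K \<Longrightarrow> y \<in> K \<Longrightarrow> F x - F y \<in> Yt"
    and Q: "\<And>N. bounded_linear (Q N)" and "D > 0"
    and bound: "\<And>N y. y \<in> Yt \<Longrightarrow> norm (Q N y) \<le> D * norm y"
    and conv: "\<And>y. y \<in> Yt \<Longrightarrow> ((\<lambda>N. norm (y - Q N y)) \<longlongrightarrow> 0) \<F>"
  obtains r c where "0 < r" "0 < c"
    "\<forall>\<^sub>F N in \<F>. \<forall>x\<in>K \<inter> ball x0 r. \<forall>y\<in>K \<inter> ball y0 r. c \<le> norm (Q N (F x) - Q N (F y))"
proof -
  define d where "d = norm (F x0 - F y0)"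
  have d: "d > 0" using \<open>F x0 \<noteq> F y0\<close> by (simp add: d_def)
  \<comment> \<open>\<open>Q N\<close> may shorten \<open>F x0 - F y0\<close> by \<open>d / 4\<close>; moving each endpoint costs at most another \<open>d / 4\<close>.\<close>
  define \<epsilon> where "\<epsilon> = d / (4 * D)"
  have "\<epsilon> > 0" using d \<open>D > 0\<close> by (simp add: \<epsilon>_def)
  have near: "\<exists>r>0. \<forall>x\<in>K \<inter> ball z r. norm (F x - F z) < \<epsilon>" if z: "z \<in> K" for z
  proof -
    obtain r where "r > 0" and r: "\<forall>x\<in>K. dist x z < r \<longrightarrow> dist (F x) (F z) < \<epsilon>"
      using F z \<open>\<epsilon> > 0\<close> unfolding continuous_on_iff by blast
    moreover have "norm (F x - F z) < \<epsilon>" if "x \<in> K \<inter> ball z r" for x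
      using r[rule_format, of x] that unfolding dist_norm[of "F x" "F z"] by (simp add: dist_commute)
    ultimately show ?thesis by blast
  qed
  obtain r1 where r1: "r1 > 0" "\<And>x. x \<in> K \<inter> ball x0 r1 \<Longrightarrow> norm (F x - F x0) < \<epsilon>"
    using near[OF \<open>x0 \<in> K\<close>] by blast
  obtain r2 where r2: "r2 > 0" "\<And>y. y \<in> K \<inter> ball y0 r2 \<Longrightarrow> norm (F y - F y0) < \<epsilon>"
    using near[OF \<open>y0 \<in> K\<close>] by blast
  define r where "r = min r1 r2"
  have move: "norm (Q N (F x - F z)) \<le> d/4" if "x \<in> K" "z \<in> K" "norm (F x - F z) < \<epsilon>" for N x z
  proof -
    have "norm (Q N (F x - F z)) \<le> D * norm (F x - F z)" using bound diff that by blast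
    also have "\<dots> \<le> D * \<epsilon>" using that \<open>D > 0\<close> by (intro mult_left_mono) auto
    finally show ?thesis using \<open>D > 0\<close> by (simp add: \<epsilon>_def)
  qed
  have "\<forall>\<^sub>F N in \<F>. norm ((F x0 - F y0) - Q N (F x0 - F y0)) < d/4"
    using conv[OF diff[OF \<open>x0 \<in> K\<close> \<open>y0 \<in> K\<close>]] d by (intro order_tendstoD(2)) auto
  then have "\<forall>\<^sub>F N in \<F>. \<forall>x\<in>K \<inter> ball x0 r. \<forall>y\<in>K \<inter> ball y0 r.
      d/4 \<le> norm (Q N (F x) - Q N (F y))"
  proof eventually_elim
    case (elim N)
    show ?case
    proof (intro ballI)
      fix x y assume x: "x \<in> K \<inter> ball x0 r" and y: "y \<in> K \<inter> ball y0 r"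
      interpret Q: bounded_linear "Q N" by (rule Q)
      have split: "Q N (F x0 - F y0) =
          (Q N (F x) - Q N (F y)) - (Q N (F x - F x0) - Q N (F y - F y0))"
        by (simp add: Q.diff)
      have "norm (Q N (F x - F x0)) \<le> d/4"
        using x \<open>x0 \<in> K\<close> r1(2) by (intro move) (auto simp: r_def)
      moreover have "norm (Q N (F y - F y0)) \<le> d/4"
        using y \<open>y0 \<in> K\<close> r2(2) by (intro move) (auto simp: r_def)
      moreover have "d \<le> norm ((F x0 - F y0) - Q N (F x0 - F y0)) + norm (Q N (F x0 - F y0))"
        using norm_triangle_ineq[of "(F x0 - F y0) - Q N (F x0 - F y0)" "Q N (F x0 - F y0)"]
        by (simp add: d_def)
      moreover have "norm (Q N (F x0 - F y0)) \<le> norm (Q N (F x) - Q N (F y)) +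
          (norm (Q N (F x - F x0)) + norm (Q N (F y - F y0)))"
        unfolding split
        by (intro order_trans[OF norm_triangle_ineq4] add_left_mono norm_triangle_ineq4)
      ultimately show "d/4 \<le> norm (Q N (F x) - Q N (F y))"
        using elim by linarith
    qed
  qed
  then show ?thesis using that[of r "d/4"] d r1(1) r2(1) by (simp add: r_def)
qed

section \<open>Transfer to the manifold\<close>

lemma C1_on_imp_continuous_on: "C1_on S f \<Longrightarrow> continuous_on S f"
  unfolding C1_on_def
  by (blast intro: has_derivative_continuous continuous_at_imp_continuous_on)

text \<open>Continuity may be tested in the charts, whose domains are relatively open and cover \<open>M\<close>.\<close>

lemma C1_manifold_imp_continuous_on:
  assumes M: "manifold_atlas M I U \<phi>" and F: "C1_manifold I U \<phi> F"
  shows "continuous_on M F"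
proof -
  have cover: "(\<Union>i\<in>I. U i) = M" and op: "\<And>i. i \<in> I \<Longrightarrow> openin (top_of_set M) (U i)"
    and hom: "\<And>i. i \<in> I \<Longrightarrow> homeomorphism (U i) (\<phi> i ` U i) (\<phi> i) (chart_inv U \<phi> i)"
    using M unfolding manifold_atlas_def by auto
  have "continuous_on (U i) F" if "i \<in> I" for i
  proof -
    have "continuous_on (U i) ((F \<circ> chart_inv U \<phi> i) \<circ> \<phi> i)"
    proof (rule continuous_on_compose)
      show "continuous_on (U i) (\<phi> i)" using hom[OF that] by (rule homeomorphism_cont1)
      show "continuous_on (\<phi> i ` U i) (F \<circ> chart_inv U \<phi> i)"
        using F that unfolding C1_manifold_def by (blast intro: C1_on_imp_continuous_on)
    qed
    then show ?thesis
      by (rule continuous_on_eq) (simp add: homeomorphism_apply1[OF hom[OF that]])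
  qed
  then have cont: "continuous_map (subtopology (top_of_set M) (U i)) euclidean F" if "i \<in> I" for i
    using that continuous_on_subset[of "U i" F "M \<inter> U i"] by (simp add: subtopology_subtopology)
  have "continuous_map (top_of_set M) euclidean F"
    using cover by (intro pasting_lemma[where T = U and f = "\<lambda>_. F", OF op cont]) auto
  then show ?thesis by simp
qed

text \<open>A ball in the image of the chart pulls back to a relatively open subset of \<open>M\<close>, so it is the trace of an
  open set \<open>V\<close> of the ambient space, the form of neighbourhood that a covering of \<open>K \<times> K\<close> needs.\<close>

lemma eventually_lower_bound_in_chart:
  assumes M: "manifold_atlas M I U \<phi>" and F: "C1_manifold I U \<phi> F" and "i \<in> I" "x0 \<in> U i"
    and inj: "inj (chart_differential U \<phi> F i x0)"
    and range: "range (chart_differential U \<phi> F i x0) \<subseteq> Yt"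
    and "subspace Yt" "\<And>N. bounded_linear (Q N)" "D > 0"
    and "\<And>N y. y \<in> Yt \<Longrightarrow> norm (Q N y) \<le> D * norm y"
    and "\<And>y. y \<in> Yt \<Longrightarrow> ((\<lambda>N. norm (y - Q N y)) \<longlongrightarrow> 0) \<F>"
  obtains V c where "open V" "x0 \<in> V" "M \<inter> V \<subseteq> U i" "0 < c"
    "\<forall>\<^sub>F N in \<F>. \<forall>x\<in>M \<inter> V. \<forall>y\<in>M \<inter> V. F x - F y \<in> Yt \<longrightarrow>
       c * norm (\<phi> i x - \<phi> i y) \<le> norm (Q N (F x) - Q N (F y))"
proof -
  let ?G = "F \<circ> chart_inv U \<phi> i"
  have hom: "homeomorphism (U i) (\<phi> i ` U i) (\<phi> i) (chart_inv U \<phi> i)"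
    and W: "open (\<phi> i ` U i)" and op: "openin (top_of_set M) (U i)"
    using M \<open>i \<in> I\<close> unfolding manifold_atlas_def by auto
  have C1: "C1_on (\<phi> i ` U i) ?G" using F \<open>i \<in> I\<close> unfolding C1_manifold_def by blast
  have p: "\<phi> i x0 \<in> \<phi> i ` U i" using \<open>x0 \<in> U i\<close> by blast
  have "?G differentiable at (\<phi> i x0)"
    using C1 p unfolding C1_on_def differentiable_def by blast
  then have "(?G has_derivative chart_differential U \<phi> F i x0) (at (\<phi> i x0))"
    unfolding chart_differential_def frechet_derivative_works .
  then obtain r c where r: "0 < r" and "0 < c"
    and ev: "\<forall>\<^sub>F N in \<F>. \<forall>u\<in>ball (\<phi> i x0) r. \<forall>v\<in>ball (\<phi> i x0) r. ?G u - ?G v \<in> Yt \<longrightarrow>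
       c * norm (u - v) \<le> norm (Q N (?G u) - Q N (?G v))"
    using lower_bound_near_regular_point[OF C1 W p _ inj range assms(7-11)] by blast
  have "openin (top_of_set (U i)) (U i \<inter> \<phi> i -` ball (\<phi> i x0) r)"
    using hom by (intro continuous_openin_preimage_gen) (auto simp: homeomorphism_def)
  then have "openin (top_of_set M) (U i \<inter> \<phi> i -` ball (\<phi> i x0) r)"
    using op by (rule openin_trans)
  then obtain V where V: "open V" "U i \<inter> \<phi> i -` ball (\<phi> i x0) r = M \<inter> V"
    by (auto simp: openin_open)
  have inv: "chart_inv U \<phi> i (\<phi> i x) = x" if "x \<in> M \<inter> V" for x
    using that homeomorphism_apply1[OF hom] V(2) by blast
  from ev have "\<forall>\<^sub>F N in \<F>. \<forall>x\<in>M \<inter> V. \<forall>y\<in>M \<inter> V. F x - F y \<in> Yt \<longrightarrow>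
       c * norm (\<phi> i x - \<phi> i y) \<le> norm (Q N (F x) - Q N (F y))"
  proof eventually_elim
    case (elim N)
    show ?case
    proof (intro ballI impI)
      fix x y assume xy: "x \<in> M \<inter> V" "y \<in> M \<inter> V" "F x - F y \<in> Yt"
      have "\<phi> i x \<in> ball (\<phi> i x0) r" "\<phi> i y \<in> ball (\<phi> i x0) r"
        using xy V(2) by blast+
      from elim[rule_format, OF this] show "c * norm (\<phi> i x - \<phi> i y) \<le> norm (Q N (F x) - Q N (F y))"
        using xy by (simp add: inv)
    qed
  qed
  moreover have "x0 \<in> U i \<inter> \<phi> i -` ball (\<phi> i x0) r" using \<open>x0 \<in> U i\<close> r by simp
  then have "x0 \<in> V" using V(2) by blast
  ultimately show ?thesis using that[of V c] V \<open>0 < c\<close> by blast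
qed

section \<open>Uniform stability of the projected map\<close>

theorem theorem2p5:
  fixes M K :: "'x::banach set"
    and I :: "'i set"
    and U :: "'i \<Rightarrow> 'x set"
    and \<phi> :: "'i \<Rightarrow> 'x \<Rightarrow> real ^ 'n::finite"
    and Q :: "nat \<Rightarrow> 'y::banach \<Rightarrow> 'y"
    and Yt :: "'y set"
    and D :: real
    and F :: "'x \<Rightarrow> 'y"
  assumes "manifold_atlas M I U \<phi>"
    and "lipschitz_atlas I U \<phi>"
    and "K \<subseteq> M" and "compact K"
    and "\<And>N. bounded_linear (Q N)"
    and "subspace Yt" and "D > 0"
    and "\<And>N. onorm_on Yt (Q N) \<le> D"
    and "\<And>y. y \<in> Yt \<Longrightarrow> (\<lambda>N. norm (y - Q N y)) \<longlonglongrightarrow> 0"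
    and "C1_manifold I U \<phi> F"
    and "inj_on F M"
    and "\<And>x. x \<in> M \<Longrightarrow> inj (manifold_differential I U \<phi> F x)"
    and "\<And>x y. x \<in> K \<Longrightarrow> y \<in> K \<Longrightarrow> F x - F y \<in> Yt"
    and "\<And>x. x \<in> M \<Longrightarrow> range (manifold_differential I U \<phi> F x) \<subseteq> Yt"
  shows "\<exists>C>0. \<forall>\<^sub>F N in sequentially. \<forall>x\<in>K. \<forall>y\<in>K.
           norm (x - y) \<le> C * norm (Q N (F x) - Q N (F y))"
proof -
  note M = assms(1) and C1 = assms(10)
  have bound: "norm (Q N y) \<le> D * norm y" if "y \<in> Yt" for N y
    using onorm_on_le_iff[OF assms(5,6)] assms(7,8) that by (meson less_imp_le)
  have contF: "continuous_on K F"
    using C1_manifold_imp_continuous_on[OF M C1] assms(3) continuous_on_subset by blast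
  obtain l where l: "0 < l"
    "\<And>i x y. i \<in> I \<Longrightarrow> x \<in> U i \<Longrightarrow> y \<in> U i \<Longrightarrow> l * norm (x - y) \<le> norm (\<phi> i x - \<phi> i y)"
    using assms(2) unfolding lipschitz_atlas_def by blast
  have "\<exists>C>0. \<forall>\<^sub>F N in sequentially. \<forall>z\<in>K \<times> K.
      norm (fst z - snd z) \<le> C * norm (Q N (F (fst z)) - Q N (F (snd z)))"
  proof (rule local_bounds_imp_bound_on_compact)
    show "compact (K \<times> K)" using assms(4) by (intro compact_Times)
  next
    fix z assume "z \<in> K \<times> K"
    then obtain x0 y0 where z: "z = (x0, y0)" and K: "x0 \<in> K" "y0 \<in> K" by blast
    show "\<exists>V C. open V \<and> z \<in> V \<and> (\<forall>\<^sub>F N in sequentially. \<forall>q\<in>K \<times> K \<inter> V.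
        norm (fst q - snd q) \<le> C * norm (Q N (F (fst q)) - Q N (F (snd q))))"
    proof (cases "x0 = y0")
      case True
      have "x0 \<in> M" using K assms(3) by blast
      then obtain i where i: "i \<in> I" "x0 \<in> U i"
        using M unfolding manifold_atlas_def by blast
      have inj: "inj (chart_differential U \<phi> F i x0)"
        and range: "range (chart_differential U \<phi> F i x0) \<subseteq> Yt"
        using inj_range_manifold_differential[OF M C1 i] assms(12,14)[OF \<open>x0 \<in> M\<close>] by simp_all
      obtain V c where V: "open V" "x0 \<in> V" "M \<inter> V \<subseteq> U i" "0 < c"
        and ev: "\<forall>\<^sub>F N in sequentially. \<forall>x\<in>M \<inter> V. \<forall>y\<in>M \<inter> V. F x - F y \<in> Yt \<longrightarrow>
          c * norm (\<phi> i x - \<phi> i y) \<le> norm (Q N (F x) - Q N (F y))"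
        by (rule eventually_lower_bound_in_chart[OF M C1 i inj range assms(6,5,7) bound assms(9)])
      from ev have "\<forall>\<^sub>F N in sequentially. \<forall>q\<in>K \<times> K \<inter> V \<times> V.
        norm (fst q - snd q) \<le> 1 / (c * l) * norm (Q N (F (fst q)) - Q N (F (snd q)))"
      proof eventually_elim
        case (elim N)
        show ?case
        proof
          fix q assume "q \<in> K \<times> K \<inter> V \<times> V"
          then obtain x y where q: "q = (x, y)" "x \<in> K" "y \<in> K" and xy: "x \<in> M \<inter> V" "y \<in> M \<inter> V"
            using assms(3) by auto
          have "c * (l * norm (x - y)) \<le> c * norm (\<phi> i x - \<phi> i y)"
            using l(2)[of i x y] i xy V by (intro mult_left_mono) auto
          also have "\<dots> \<le> norm (Q N (F x) - Q N (F y))"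
            using elim xy assms(13)[OF q(2,3)] by blast
          finally show "norm (fst q - snd q) \<le> 1 / (c * l) * norm (Q N (F (fst q)) - Q N (F (snd q)))"
            using \<open>0 < c\<close> \<open>0 < l\<close> q(1) by (simp add: field_simps)
        qed
      qed
      moreover have "open (V \<times> V)" "z \<in> V \<times> V"
        using V(1,2) True by (simp_all add: z open_Times)
      ultimately show ?thesis by blast
    next
      case False
      then have "F x0 \<noteq> F y0"
        using inj_onD[OF assms(11)] K assms(3) by blast
      then obtain r c where r: "0 < r" and "0 < c"
        and ev: "\<forall>\<^sub>F N in sequentially. \<forall>x\<in>K \<inter> ball x0 r. \<forall>y\<in>K \<inter> ball y0 r.
          c \<le> norm (Q N (F x) - Q N (F y))"
        by (rule lower_bound_off_diagonal[OF contF K _ assms(13,5,7) bound assms(9)])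
      from ev have "\<forall>\<^sub>F N in sequentially. \<forall>q\<in>K \<times> K \<inter> ball x0 r \<times> ball y0 r.
        norm (fst q - snd q) \<le> diameter K / c * norm (Q N (F (fst q)) - Q N (F (snd q)))"
      proof eventually_elim
        case (elim N)
        show ?case
        proof
          fix q assume "q \<in> K \<times> K \<inter> ball x0 r \<times> ball y0 r"
          then obtain x y where q: "q = (x, y)" and xy: "x \<in> K \<inter> ball x0 r" "y \<in> K \<inter> ball y0 r"
            by auto
          have "norm (x - y) \<le> diameter K"
            using diameter_bounded_bound[OF compact_imp_bounded[OF assms(4)], of x y] xy
            by (simp add: dist_norm)
          also have "\<dots> = diameter K / c * c" using \<open>0 < c\<close> by simp
          also have "\<dots> \<le> diameter K / c * norm (Q N (F x) - Q N (F y))"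
            using elim xy \<open>0 < c\<close> diameter_ge_0[OF compact_imp_bounded[OF assms(4)]]
            by (intro mult_left_mono) auto
          finally show "norm (fst q - snd q) \<le> diameter K / c * norm (Q N (F (fst q)) - Q N (F (snd q)))"
            by (simp add: q)
        qed
      qed
      moreover have "open (ball x0 r \<times> ball y0 r)" "z \<in> ball x0 r \<times> ball y0 r"
        using r by (simp_all add: z open_Times)
      ultimately show ?thesis by blast
    qed
  qed simp
  then show ?thesis by simp
qed

end
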